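(* There is an absolute constant $k>0$ such that for every $0<q\le 1$, every $n\in\mathbb{N}$ and every $m\in\mathbb{N}$, the genuine $q$-Bernstein--Durrmeyer operator $U_{n,q}$ satisfies $$|U_{n,q}^m(f;x)-P(f;x)|\le k\,\omega_2\left(f,\sqrt{\left(1-\frac{[2]_q}{[n+1]_q}\right)^m x(1-x)}\right)$$ for all $x\in[0,1]$ and $f\in C[0,1]$.
   Context: $\mathbb{N}=\{1,2,\dots\}$. For $0<q<1$, $[n]_q=\frac{1-q^n}{1-q}$, and $[n]_1=n$; $[n]_q!=[1]_q[2]_q\cdots[n]_q$, $[0]_q!=1$; $\left[\begin{smallmatrix} n \\ k \end{smallmatrix}\right]_q=\frac{[n]_q!}{[k]_q!\,[n-k]_q!}$ for $0\le k\le n$. $p_{n,j}(q;x)=\left[\begin{smallmatrix} n \\ j \end{smallmatrix}\right]_q x^j\prod_{s=0}^{n-j-1}(1-q^s x)$ (empty products equal $1$). For $0<q<1$ the $q$-integral is $\int_0^1 g(t)\,d_qt=(1-q)\sum_{i=0}^\infty q^i g(q^i)$, and for $q=1$ it is the usual integral. The genuine $q$-Bernstein--Durrmeyer operator $U_{n,q}:C[0,1]\to C[0,1]$ is $$U_{n,q}(f;x)=f(0)p_{n,0}(q;x)+f(1)p_{n,n}(q;x)+[n-1]_q\sum_{j=1}^{n-1}q^{1-j}p_{n,j}(q;x)\int_0^1 p_{n-2,j-1}(q;qt)f(t)\,d_qt$$ (the sum is empty for $n=1$). $C[0,1]$ is the space of real-valued continuous functions on $[0,1]$; $U_{n,q}^m$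 is the $m$-fold composition of $U_{n,q}$, and $U_{n,q}^m(f;x)$ is the value of $U_{n,q}^m(f)$ at $x$. $P(f;x)=(1-x)f(0)+xf(1)$. The second modulus of smoothness of $f$ is $\omega_2(f,t)=\sup_{0<h\le t}\ \sup_{0\le x\le 1-2h}|f(x+2h)-2f(x+h)+f(x)|$ for $t\ge 0$, with the convention that a supremum over an empty set is $0$ (so $\omega_2(f,0)=0$). "Absolute constant" means independent of $q$, $n$, $m$, $x$ and $f$. *)

theory Defs
  imports "HOL-Analysis.Analysis"
begin

definition q_int :: "real \<Rightarrow> nat \<Rightarrow> real" where
  "q_int q n = (if q = 1 then real n else (1 - q ^ n) / (1 - q))"

definition q_fact :: "real \<Rightarrow> nat \<Rightarrow> real" where
  "q_fact q n = (\<Prod>i=1..n. q_int q i)"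

text \<open>Only meaningful for \<open>k \<le> n\<close>, because of the truncated subtraction.\<close>

definition q_binomial :: "real \<Rightarrow> nat \<Rightarrow> nat \<Rightarrow> real" where
  "q_binomial q n k = q_fact q n / (q_fact q k * q_fact q (n - k))"

definition q_bernstein :: "nat \<Rightarrow> nat \<Rightarrow> real \<Rightarrow> real \<Rightarrow> real" where
  "q_bernstein n j q x = q_binomial q n j * x ^ j * (\<Prod>s<n - j. 1 - q ^ s * x)"

definition q_integral :: "real \<Rightarrow> (real \<Rightarrow> real) \<Rightarrow> real" where
  "q_integral q g =
     (if q = 1 then integral {0..1} g else (1 - q) * (\<Sum>i. q ^ i * g (q ^ i)))"

text \<open>
  Elements of \<open>C[0,1]\<close> are represented by functions on the reals that are continuous on
  \<open>{0..1}\<close>. For \<open>0 < q \<le> 1\<close> the operator below depends only on the values of its argument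
  on \<open>{0..1}\<close>, and it returns a polynomial, so its iterates are those of the operator on
  \<open>C[0,1]\<close>.
\<close>

definition q_bernstein_durrmeyer :: "nat \<Rightarrow> real \<Rightarrow> (real \<Rightarrow> real) \<Rightarrow> real \<Rightarrow> real" where
  "q_bernstein_durrmeyer n q f x =
     f 0 * q_bernstein n 0 q x + f 1 * q_bernstein n n q x +
     q_int q (n - 1) *
       (\<Sum>j=1..n - 1. q powi (1 - int j) * q_bernstein n j q x *
          q_integral q (\<lambda>t. q_bernstein (n - 2) (j - 1) q (q * t) * f t))"

definition endpoint_interpolant :: "(real \<Rightarrow> real) \<Rightarrow> real \<Rightarrow> real" where
  "endpoint_interpolant f x = (1 - x) * f 0 + x * f 1"

text \<open>The value of \<^term>\<open>Sup {} :: real\<close> is unspecified; here it is fixed as 0.\<close>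

definition Sup0 :: "real set \<Rightarrow> real" where
  "Sup0 S = (if S = {} then 0 else Sup S)"

definition second_modulus :: "(real \<Rightarrow> real) \<Rightarrow> real \<Rightarrow> real" where
  "second_modulus f t =
     Sup0 ((\<lambda>h. Sup0 ((\<lambda>x. \<bar>f (x + 2 * h) - 2 * f (x + h) + f x\<bar>) ` {0..1 - 2 * h})) ` {0<..t})"

end

theory Submission
  imports Defs
begin

text \<open>
  The estimate rests on three properties of the operator \<open>U\<close> (\<^const>\<open>q_bernstein_durrmeyer\<close>) and
  on nothing else about it: it is monotone, it reproduces affine functions, and \<open>t (1 - t)\<close> is an
  eigenfunction with eigenvalue \<open>\<lambda> = 1 - [2]/[n + 1]\<close> (lemmas \<open>q_bernstein_durrmeyer_mono\<close> and
  \<open>q_bernstein_durrmeyer_eigen\<close>). All three pass to the iterates, with \<open>\<lambda> ^ m\<close> for the eigenvalue.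

  The analytic ingredient is a maximum principle (\<open>chord_deviation_le\<close>): if all second differences
  of \<open>f\<close> with steps up to \<open>\<delta>\<close> are at most \<open>W\<close>, then \<open>f\<close> differs from its chord \<open>P f\<close> by at
  most \<open>W + W t (1 - t) / \<delta>\<^sup>2\<close> at \<open>t\<close>. Both \<open>P f\<close> and this majorant are combinations of
  eigenfunctions, so applying \<open>U ^ m\<close> to \<open>P f - majorant \<le> f \<le> P f + majorant\<close> gives
  \<open>\<bar>U ^ m f - P f\<bar> \<le> W + W \<lambda> ^ m x (1 - x) / \<delta>\<^sup>2\<close>, which is \<open>2 W\<close> for the \<open>\<delta>\<close> of the theorem.
  This replaces the usual passage through a K-functional and shows that \<open>2\<close> is an admissible
  constant. When that \<open>\<delta>\<close> is zero, the modulus is zero as well, but uniform continuity supplies an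
  arbitrarily small \<open>W\<close> for some positive step (\<open>chord_deviation_modulus\<close> treats both cases).

  The eigenvalue comes from the first three moments. A \<open>q\<close>-beta integral turns the integrals
  against monomials into quotients of \<open>q\<close>-integers, and the remaining sums over the \<open>q\<close>-Bernstein
  basis follow from one recursion in the degree (\<open>sum_q_bernstein_Suc\<close>).
\<close>

section \<open>Second differences and the distance to the chord\<close>

text \<open>
  Look at a maximum point \<open>t\<close> of the deviation minus \<open>W t (1 - t) / \<delta>\<^sup>2\<close>. The parabola contributes
  \<open>2 W\<close> to a second difference of step \<open>\<delta>\<close>, so if such a step fits around \<open>t\<close>, that second
  difference is positive, contradicting maximality. Hence \<open>t\<close> is within \<open>\<delta>\<close> of an endpoint, and
  the largest symmetric step reaches an endpoint, where the function vanishes; comparing the three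
  values there bounds the maximum by \<open>W\<close>.
\<close>

lemma chord_deviation_le:
  fixes f :: "real \<Rightarrow> real"
  assumes cont: "continuous_on {0..1} f" and "W > 0" "\<delta> > 0"
    and diff: "\<And>h x. 0 < h \<Longrightarrow> h \<le> \<delta> \<Longrightarrow> 0 \<le> x \<Longrightarrow> x \<le> 1 - 2 * h \<Longrightarrow>
      \<bar>f (x + 2 * h) - 2 * f (x + h) + f x\<bar> \<le> W"
    and t: "t \<in> {0..1}"
  shows "f t - endpoint_interpolant f t \<le> W + W / \<delta>\<^sup>2 * (t * (1 - t))"
proof -
  define G where "G t = f t - endpoint_interpolant f t - W / \<delta>\<^sup>2 * (t * (1 - t))" for t
  have G01: "G 0 = 0" "G 1 = 0"
    by (auto simp: G_def endpoint_interpolant_def)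
  have "continuous_on {0..1} G"
    unfolding G_def endpoint_interpolant_def by (intro continuous_intros cont)
  then obtain t0 where t0: "t0 \<in> {0..1}" and max: "\<And>y. y \<in> {0..1} \<Longrightarrow> G y \<le> G t0"
    using continuous_attains_sup[of "{0..1::real}" G] by auto
  have "G t0 \<le> W"
  proof (cases "t0 = 0 \<or> t0 = 1")
    case True
    then show ?thesis using G01 \<open>W > 0\<close> by auto
  next
    case False
    define s where "s = min \<delta> (min t0 (1 - t0))"
    have s: "0 < s" "s \<le> \<delta>" "s \<le> t0" "s \<le> 1 - t0"
      using False t0 \<open>\<delta> > 0\<close> by (auto simp: s_def)
    have "\<bar>f (t0 + s) - 2 * f t0 + f (t0 - s)\<bar> \<le> W"
      using diff[of s "t0 - s"] s by (simp add: algebra_simps)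
    moreover have "G (t0 + s) - 2 * G t0 + G (t0 - s) =
        (f (t0 + s) - 2 * f t0 + f (t0 - s)) + 2 * (W / \<delta>\<^sup>2) * s\<^sup>2"
    proof -
      define c where "c = W / \<delta>\<^sup>2"
      show ?thesis
        unfolding G_def endpoint_interpolant_def c_def[symmetric]
        by (simp add: algebra_simps power2_eq_square)
    qed
    ultimately have key: "2 * G t0 \<le> G (t0 + s) + G (t0 - s) + W - 2 * (W / \<delta>\<^sup>2) * s\<^sup>2"
      by linarith
    have le: "G (t0 + s) \<le> G t0" "G (t0 - s) \<le> G t0"
      using max s t0 by auto
    show ?thesis
    proof (cases "s = \<delta>")
      case True
      then have "(W / \<delta>\<^sup>2) * s\<^sup>2 = W" using \<open>\<delta> > 0\<close> by simp
      then show ?thesis using key le \<open>W > 0\<close> by linarith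
    next
      case False
      then have "t0 - s = 0 \<or> t0 + s = 1" by (auto simp: s_def min_def split: if_splits)
      then have "G (t0 - s) = 0 \<or> G (t0 + s) = 0" using G01 by auto
      moreover have "0 \<le> (W / \<delta>\<^sup>2) * s\<^sup>2" using \<open>W > 0\<close> by simp
      ultimately show ?thesis using key le by linarith
    qed
  qed
  then have "G t \<le> W" using max[OF t] by linarith
  then show ?thesis by (simp add: G_def)
qed

lemma abs_chord_deviation_le:
  fixes f :: "real \<Rightarrow> real"
  assumes cont: "continuous_on {0..1} f" and "W > 0" "\<delta> > 0"
    and diff: "\<And>h x. 0 < h \<Longrightarrow> h \<le> \<delta> \<Longrightarrow> 0 \<le> x \<Longrightarrow> x \<le> 1 - 2 * h \<Longrightarrow>
      \<bar>f (x + 2 * h) - 2 * f (x + h) + f x\<bar> \<le> W"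
    and t: "t \<in> {0..1}"
  shows "\<bar>f t - endpoint_interpolant f t\<bar> \<le> W + W / \<delta>\<^sup>2 * (t * (1 - t))"
proof -
  have "(- f t) - endpoint_interpolant (\<lambda>t. - f t) t \<le> W + W / \<delta>\<^sup>2 * (t * (1 - t))"
  proof (rule chord_deviation_le)
    fix h x :: real
    assume "0 < h" "h \<le> \<delta>" "0 \<le> x" "x \<le> 1 - 2 * h"
    from diff[OF this] show "\<bar>- f (x + 2 * h) - 2 * - f (x + h) + - f x\<bar> \<le> W" by linarith
  qed (use assms in \<open>auto intro: continuous_intros\<close>)
  moreover have "endpoint_interpolant (\<lambda>t. - f t) t = - endpoint_interpolant f t"
    by (simp add: endpoint_interpolant_def algebra_simps)
  ultimately show ?thesis
    using chord_deviation_le[OF assms] by linarith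
qed

lemma Sup0_upper: "bdd_above S \<Longrightarrow> a \<in> S \<Longrightarrow> a \<le> Sup0 S"
  by (auto simp: Sup0_def intro: cSup_upper)

lemma Sup0_least: "0 \<le> c \<Longrightarrow> (\<And>a. a \<in> S \<Longrightarrow> a \<le> c) \<Longrightarrow> Sup0 S \<le> c"
  by (auto simp: Sup0_def intro: cSup_least)

lemma continuous_on_unit_interval_bounded:
  fixes f :: "real \<Rightarrow> real"
  assumes "continuous_on {0..1} f"
  obtains M where "M \<ge> 0" "\<And>x. x \<in> {0..1} \<Longrightarrow> \<bar>f x\<bar> \<le> M"
proof -
  have "bounded (f ` {0..1})"
    using assms compact_continuous_image compact_imp_bounded by blast
  then obtain M where "\<And>x. x \<in> {0..1} \<Longrightarrow> \<bar>f x\<bar> \<le> M"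
    unfolding bounded_iff by (metis imageI real_norm_def)
  then have "0 \<le> \<bar>M\<bar>" "\<And>x. x \<in> {0..1} \<Longrightarrow> \<bar>f x\<bar> \<le> \<bar>M\<bar>"
    by (auto intro: order_trans[OF _ abs_ge_self])
  then show ?thesis by (rule that)
qed

lemma second_difference_le_modulus:
  fixes f :: "real \<Rightarrow> real"
  assumes "continuous_on {0..1} f" and "0 < h" "h \<le> \<delta>" "0 \<le> x" "x \<le> 1 - 2 * h"
  shows "\<bar>f (x + 2 * h) - 2 * f (x + h) + f x\<bar> \<le> second_modulus f \<delta>"
proof -
  obtain M where M: "M \<ge> 0" "\<And>x. x \<in> {0..1} \<Longrightarrow> \<bar>f x\<bar> \<le> M"
    using continuous_on_unit_interval_bounded[OF assms(1)] by blast
  define S where "S h = (\<lambda>x. \<bar>f (x + 2 * h) - 2 * f (x + h) + f x\<bar>) ` {0..1 - 2 * h}" for h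
  have bound: "a \<le> 4 * M" if "a \<in> S h" "h > 0" for a h
  proof -
    from that obtain y where y: "0 \<le> y" "y \<le> 1 - 2 * h"
      and a: "a = \<bar>f (y + 2 * h) - 2 * f (y + h) + f y\<bar>"
      by (auto simp: S_def)
    have "\<bar>f (y + 2 * h)\<bar> \<le> M" "\<bar>f (y + h)\<bar> \<le> M" "\<bar>f y\<bar> \<le> M"
      using y \<open>h > 0\<close> by (auto intro!: M(2))
    then show ?thesis unfolding a by linarith
  qed
  have "\<bar>f (x + 2 * h) - 2 * f (x + h) + f x\<bar> \<le> Sup0 (S h)"
    using assms bound by (intro Sup0_upper bdd_aboveI[of _ "4 * M"]) (auto simp: S_def)
  also have "\<dots> \<le> Sup0 ((\<lambda>h. Sup0 (S h)) ` {0<..\<delta>})"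
    using assms bound M
    by (intro Sup0_upper bdd_aboveI[of _ "4 * M"]) (auto intro!: Sup0_least)
  finally show ?thesis by (simp add: second_modulus_def S_def)
qed

lemma second_modulus_nonneg:
  fixes f :: "real \<Rightarrow> real"
  assumes "continuous_on {0..1} f"
  shows "0 \<le> second_modulus f \<delta>"
proof (cases "\<delta> > 0")
  case True
  define h where "h = min \<delta> (1/2)"
  have "\<bar>f (0 + 2 * h) - 2 * f (0 + h) + f 0\<bar> \<le> second_modulus f \<delta>"
    using True by (intro second_difference_le_modulus assms) (auto simp: h_def)
  then show ?thesis by linarith
qed (simp add: second_modulus_def Sup0_def)

lemma small_second_differences:
  fixes f :: "real \<Rightarrow> real"
  assumes "continuous_on {0..1} f" "W > 0"
  obtains \<delta> where "\<delta> > 0"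
    "\<And>h x. 0 < h \<Longrightarrow> h \<le> \<delta> \<Longrightarrow> 0 \<le> x \<Longrightarrow> x \<le> 1 - 2 * h \<Longrightarrow>
      \<bar>f (x + 2 * h) - 2 * f (x + h) + f x\<bar> \<le> W"
proof -
  have "uniformly_continuous_on {0..1} f"
    using assms(1) compact_uniformly_continuous by blast
  then obtain d where d: "d > 0"
    "\<And>x y. x \<in> {0..1} \<Longrightarrow> y \<in> {0..1} \<Longrightarrow> dist y x < d \<Longrightarrow> dist (f y) (f x) < W / 2"
    unfolding uniformly_continuous_on_def using \<open>W > 0\<close> by (metis half_gt_zero)
  show ?thesis
  proof (rule that[of "d / 2"])
    fix h x :: real
    assume h: "0 < h" "h \<le> d / 2" "0 \<le> x" "x \<le> 1 - 2 * h"
    have "dist (f (x + 2 * h)) (f (x + h)) < W / 2"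
      by (rule d(2)) (use h \<open>d > 0\<close> in \<open>auto simp: dist_real_def\<close>)
    moreover have "dist (f x) (f (x + h)) < W / 2"
      by (rule d(2)) (use h \<open>d > 0\<close> in \<open>auto simp: dist_real_def\<close>)
    ultimately show "\<bar>f (x + 2 * h) - 2 * f (x + h) + f x\<bar> \<le> W"
      unfolding dist_real_def by linarith
  qed (use d in auto)
qed

text \<open>
  Allowing \<open>\<delta> = 0\<close> here covers the case where the bound of the theorem must vanish: the second
  inequality is then trivial, and uniform continuity provides the positive step that the maximum
  principle needs. The slack \<open>e\<close> is there because the maximum principle also needs a positive bound
  on the second differences, while the modulus of an affine function is \<open>0\<close>.
\<close>

lemma chord_deviation_modulus:
  fixes f :: "real \<Rightarrow> real"
  assumes cont: "continuous_on {0..1} f" and "\<delta> \<ge> 0" "e > 0"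
  obtains c where "c * \<delta>\<^sup>2 \<le> second_modulus f \<delta> + e"
    "\<And>t. t \<in> {0..1} \<Longrightarrow>
      \<bar>f t - endpoint_interpolant f t\<bar> \<le> second_modulus f \<delta> + e + c * (t * (1 - t))"
proof -
  define W where "W = second_modulus f \<delta> + e"
  have W: "W > 0"
    using second_modulus_nonneg[OF cont, of \<delta>] \<open>e > 0\<close> by (simp add: W_def)
  obtain \<eta> where \<eta>: "\<eta> > 0" "\<delta> \<le> \<eta>"
    "\<And>h x. 0 < h \<Longrightarrow> h \<le> \<eta> \<Longrightarrow> 0 \<le> x \<Longrightarrow> x \<le> 1 - 2 * h \<Longrightarrow>
      \<bar>f (x + 2 * h) - 2 * f (x + h) + f x\<bar> \<le> W"
  proof (cases "\<delta> = 0")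
    case True
    then show ?thesis
      using that small_second_differences[OF cont W] by (metis less_imp_le)
  next
    case False
    have "\<bar>f (x + 2 * h) - 2 * f (x + h) + f x\<bar> \<le> W"
      if "0 < h" "h \<le> \<delta>" "0 \<le> x" "x \<le> 1 - 2 * h" for h x
      using second_difference_le_modulus[OF cont that] \<open>e > 0\<close> by (simp add: W_def)
    then show ?thesis
      using False \<open>\<delta> \<ge> 0\<close> by (intro that[of \<delta>]) auto
  qed
  show ?thesis
  proof (rule that[of "W / \<eta>\<^sup>2"])
    have "\<delta>\<^sup>2 \<le> \<eta>\<^sup>2"
      using \<eta> \<open>\<delta> \<ge> 0\<close> by (intro power_mono)
    then have "W * \<delta>\<^sup>2 \<le> W * \<eta>\<^sup>2"
      using W by (intro mult_left_mono) auto
    then show "W / \<eta>\<^sup>2 * \<delta>\<^sup>2 \<le> second_modulus f \<delta> + e"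
      using \<eta>(1) by (simp add: W_def[symmetric] divide_simps)
    show "\<bar>f t - endpoint_interpolant f t\<bar> \<le>
        second_modulus f \<delta> + e + W / \<eta>\<^sup>2 * (t * (1 - t))" if "t \<in> {0..1}" for t
      unfolding W_def[symmetric] by (rule abs_chord_deviation_le[OF cont W \<eta>(1,3) that])
  qed
qed

section \<open>Moments of the q-Bernstein basis\<close>

lemma q_int_0 [simp]: "q_int q 0 = 0"
  by (simp add: q_int_def)

lemma q_int_Suc: "q_int q (Suc n) = q_int q n + q ^ n"
  by (simp add: q_int_def field_simps)

lemma q_int_Suc': "q_int q (Suc n) = 1 + q * q_int q n"
  by (simp add: q_int_def field_simps)

lemma q_int_add: "q_int q (m + n) = q_int q n + q ^ n * q_int q m"
  by (simp add: q_int_def field_simps power_add)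

lemma q_int_nonneg: "0 < q \<Longrightarrow> 0 \<le> q_int q n"
  by (induction n) (simp_all add: q_int_Suc)

lemma q_int_pos: "0 < q \<Longrightarrow> 0 < n \<Longrightarrow> 0 < q_int q n"
  by (cases n) (simp_all add: q_int_Suc add_nonneg_pos q_int_nonneg)

lemma q_fact_0 [simp]: "q_fact q 0 = 1"
  by (simp add: q_fact_def)

lemma q_fact_Suc: "q_fact q (Suc n) = q_fact q n * q_int q (Suc n)"
  by (simp add: q_fact_def)

lemma q_fact_pos: "0 < q \<Longrightarrow> 0 < q_fact q n"
  by (auto simp: q_fact_def intro!: prod_pos q_int_pos)

lemma q_binomial_0: "0 < q \<Longrightarrow> q_binomial q n 0 = 1"
  using q_fact_pos[of q n] by (simp add: q_binomial_def)

lemma q_binomial_self: "0 < q \<Longrightarrow> q_binomial q n n = 1"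
  using q_fact_pos[of q n] by (simp add: q_binomial_def)

lemma q_binomial_Suc_Suc:
  assumes "0 < q" "k < n"
  shows "q_binomial q (Suc n) (Suc k) = q ^ (n - k) * q_binomial q n k + q_binomial q n (Suc k)"
proof -
  from assms(2) obtain d where n: "n = k + Suc d"
    using less_imp_Suc_add by auto
  have "q_int q (Suc n) = q_int q (Suc k + Suc d)"
    by (simp add: n)
  also have "\<dots> = q_int q (Suc d) + q ^ Suc d * q_int q (Suc k)"
    by (rule q_int_add)
  finally have *: "q_int q (Suc n) = q_int q (Suc d) + q ^ Suc d * q_int q (Suc k)" .
  have nz: "q_fact q k \<noteq> 0" "q_fact q d \<noteq> 0" "q_int q (Suc k) \<noteq> 0" "q_int q (Suc d) \<noteq> 0"
    using q_fact_pos[OF assms(1)] q_int_pos[OF assms(1)]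
    by (metis less_irrefl zero_less_Suc)+
  have 1: "q_binomial q (Suc n) (Suc k) =
      q_fact q n * q_int q (Suc n) / (q_fact q k * q_int q (Suc k) * (q_fact q d * q_int q (Suc d)))"
    by (simp add: q_binomial_def q_fact_Suc n)
  have 2: "q_binomial q n k = q_fact q n / (q_fact q k * (q_fact q d * q_int q (Suc d)))"
    "q_binomial q n (Suc k) = q_fact q n / (q_fact q k * q_int q (Suc k) * q_fact q d)"
    by (simp_all add: q_binomial_def q_fact_Suc n)
  have 3: "n - k = Suc d" by (simp add: n)
  show ?thesis
    unfolding 1 2 3 * using nz by (simp add: field_simps)
qed

lemma q_bernstein_Suc_0: "0 < q \<Longrightarrow> q_bernstein (Suc n) 0 q x = q_bernstein n 0 q x * (1 - q ^ n * x)"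
  by (simp add: q_bernstein_def q_binomial_0)

lemma q_bernstein_Suc_self: "0 < q \<Longrightarrow> q_bernstein (Suc n) (Suc n) q x = x * q_bernstein n n q x"
  by (simp add: q_bernstein_def q_binomial_self)

lemma q_bernstein_Suc_Suc:
  assumes "0 < q" "k < n"
  shows "q_bernstein (Suc n) (Suc k) q x =
    q_bernstein n (Suc k) q x * (1 - q ^ (n - Suc k) * x) + q ^ (n - k) * x * q_bernstein n k q x"
proof -
  have "n - k = Suc (n - Suc k)" using assms(2) by simp
  then have "(\<Prod>s<n - k. 1 - q ^ s * x) = (\<Prod>s<n - Suc k. 1 - q ^ s * x) * (1 - q ^ (n - Suc k) * x)"
    by simp
  then have "q_bernstein n (Suc k) q x * (1 - q ^ (n - Suc k) * x) =
      q_binomial q n (Suc k) * x ^ Suc k * (\<Prod>s<n - k. 1 - q ^ s * x)"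
    unfolding q_bernstein_def by (simp only: mult.assoc)
  moreover have "q_bernstein (Suc n) (Suc k) q x =
      (q ^ (n - k) * q_binomial q n k + q_binomial q n (Suc k)) * x ^ Suc k * (\<Prod>s<n - k. 1 - q ^ s * x)"
    by (simp only: q_bernstein_def q_binomial_Suc_Suc[OF assms] diff_Suc_Suc)
  ultimately show ?thesis
    by (simp add: q_bernstein_def[of n k] distrib_left distrib_right mult_ac)
qed

text \<open>
  For weights \<open>g\<close> built from \<open>q\<close>-integers, the increment \<open>g (j + 1) - g j\<close> carries a factor
  \<open>q ^ j\<close>, which combines with \<open>q ^ (n - j)\<close> to the constant \<open>q ^ n\<close>; each moment is thereby reduced
  to a lower one.
\<close>

lemma sum_q_bernstein_Suc:
  assumes "0 < q"
  shows "(\<Sum>j\<le>Suc n. q_bernstein (Suc n) j q x * g j) =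
    (\<Sum>j\<le>n. q_bernstein n j q x * (g j + q ^ (n - j) * x * (g (Suc j) - g j)))"
proof -
  define a where "a j = q_bernstein n j q x * (1 - q ^ (n - j) * x)" for j
  define b where "b j = q ^ (n - j) * x * q_bernstein n j q x" for j
  have "(\<Sum>j\<le>Suc n. q_bernstein (Suc n) j q x * g j) =
      q_bernstein (Suc n) 0 q x * g 0 + (\<Sum>j\<le>n. q_bernstein (Suc n) (Suc j) q x * g (Suc j))"
    by (rule sum.atMost_Suc_shift)
  also have "(\<Sum>j\<le>n. q_bernstein (Suc n) (Suc j) q x * g (Suc j)) =
      (\<Sum>j<n. q_bernstein (Suc n) (Suc j) q x * g (Suc j)) + b n * g (Suc n)"
    by (simp add: lessThan_Suc_atMost[symmetric] q_bernstein_Suc_self[OF assms] b_def)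
  also have "(\<Sum>j<n. q_bernstein (Suc n) (Suc j) q x * g (Suc j)) =
      (\<Sum>j<n. a (Suc j) * g (Suc j)) + (\<Sum>j<n. b j * g (Suc j))"
    by (simp add: q_bernstein_Suc_Suc[OF assms] a_def b_def sum.distrib[symmetric] algebra_simps)
  also have "q_bernstein (Suc n) 0 q x * g 0 +
      ((\<Sum>j<n. a (Suc j) * g (Suc j)) + (\<Sum>j<n. b j * g (Suc j)) + b n * g (Suc n)) =
      (\<Sum>j<Suc n. a j * g j) + (\<Sum>j<Suc n. b j * g (Suc j))"
    unfolding sum.lessThan_Suc_shift[of "\<lambda>j. a j * g j"]
    by (simp add: a_def q_bernstein_Suc_0[OF assms])
  also have "\<dots> = (\<Sum>j\<le>n. q_bernstein n j q x * (g j + q ^ (n - j) * x * (g (Suc j) - g j)))"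
    by (simp add: lessThan_Suc_atMost a_def b_def sum.distrib[symmetric] algebra_simps
      del: sum.lessThan_Suc sum.atMost_Suc)
  finally show ?thesis .
qed

lemma sum_q_bernstein:
  assumes "0 < q"
  shows "(\<Sum>j\<le>n. q_bernstein n j q x) = 1"
proof (induction n)
  case 0
  show ?case by (simp add: q_bernstein_def q_binomial_0[OF assms])
next
  case (Suc n)
  then show ?case using sum_q_bernstein_Suc[OF assms, of n x "\<lambda>_. 1"] by simp
qed

lemma sum_q_bernstein_q_int:
  assumes "0 < q"
  shows "(\<Sum>j\<le>n. q_bernstein n j q x * q_int q j) = q_int q n * x"
proof (induction n)
  case (Suc n)
  have "(\<Sum>j\<le>Suc n. q_bernstein (Suc n) j q x * q_int q j) =
      (\<Sum>j\<le>n. q_bernstein n j q x * q_int q j + q ^ n * x * q_bernstein n j q x)"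
    unfolding sum_q_bernstein_Suc[OF assms]
  proof (rule sum.cong[OF refl])
    fix j assume "j \<in> {..n}"
    then have "q ^ (n - j) * q ^ j = q ^ n" by (simp add: power_add[symmetric])
    then show "q_bernstein n j q x * (q_int q j + q ^ (n - j) * x * (q_int q (Suc j) - q_int q j)) =
        q_bernstein n j q x * q_int q j + q ^ n * x * q_bernstein n j q x"
      unfolding q_int_Suc by (simp add: algebra_simps)
  qed
  also have "\<dots> = q_int q n * x + q ^ n * x * 1"
    unfolding sum.distrib sum_distrib_left[symmetric] Suc.IH sum_q_bernstein[OF assms] ..
  finally show ?case by (simp add: q_int_Suc algebra_simps)
qed simp

lemma sum_q_bernstein_q_int_Suc:
  assumes "0 < q"
  shows "(\<Sum>j\<le>n. q_bernstein n j q x * q_int q (Suc j)) = 1 + q * q_int q n * x"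
proof -
  have "(\<Sum>j\<le>n. q_bernstein n j q x * q_int q (Suc j)) =
      (\<Sum>j\<le>n. q_bernstein n j q x) + q * (\<Sum>j\<le>n. q_bernstein n j q x * q_int q j)"
    by (simp add: q_int_Suc' sum_distrib_left sum.distrib[symmetric] algebra_simps)
  then show ?thesis
    by (simp add: sum_q_bernstein[OF assms] sum_q_bernstein_q_int[OF assms])
qed

lemma sum_q_bernstein_q_int_q_int_Suc:
  assumes "0 < q"
  shows "(\<Sum>j\<le>n. q_bernstein n j q x * (q_int q j * q_int q (Suc j))) =
    q_int q n * (q_int q (Suc n) * x\<^sup>2 + (1 + q) * (x - x\<^sup>2))"
proof (induction n)
  case (Suc n)
  have "(\<Sum>j\<le>Suc n. q_bernstein (Suc n) j q x * (q_int q j * q_int q (Suc j))) =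
      (\<Sum>j\<le>n. q_bernstein n j q x * (q_int q j * q_int q (Suc j)) +
        q ^ n * (1 + q) * x * (q_bernstein n j q x * q_int q (Suc j)))"
    unfolding sum_q_bernstein_Suc[OF assms]
  proof (rule sum.cong[OF refl])
    fix j assume "j \<in> {..n}"
    then have *: "q ^ (n - j) * q ^ j = q ^ n" by (simp add: power_add[symmetric])
    have "q ^ (n - j) * (q_int q (Suc j) * q_int q (Suc (Suc j)) - q_int q j * q_int q (Suc j)) =
        (q ^ (n - j) * q ^ j) * (1 + q) * q_int q (Suc j)"
      unfolding q_int_Suc[of q "Suc j"] q_int_Suc[of q j] by (simp add: algebra_simps)
    then have "q ^ (n - j) * (q_int q (Suc j) * q_int q (Suc (Suc j)) - q_int q j * q_int q (Suc j)) =
        q ^ n * (1 + q) * q_int q (Suc j)"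
      unfolding * .
    moreover have "p * (a + c * x * d) = p * a + (c * d) * x * p" for p a c d :: real
      by (simp add: algebra_simps)
    ultimately show "q_bernstein n j q x * (q_int q j * q_int q (Suc j) + q ^ (n - j) * x *
          (q_int q (Suc j) * q_int q (Suc (Suc j)) - q_int q j * q_int q (Suc j))) =
        q_bernstein n j q x * (q_int q j * q_int q (Suc j)) +
        q ^ n * (1 + q) * x * (q_bernstein n j q x * q_int q (Suc j))"
      by simp
  qed
  also have "\<dots> = q_int q n * (q_int q (Suc n) * x\<^sup>2 + (1 + q) * (x - x\<^sup>2)) +
      q ^ n * (1 + q) * x * (1 + q * q_int q n * x)"
    unfolding sum.distrib sum_distrib_left[symmetric] Suc.IH sum_q_bernstein_q_int_Suc[OF assms] ..
  also have "\<dots> = q_int q (Suc n) * (q_int q (Suc (Suc n)) * x\<^sup>2 + (1 + q) * (x - x\<^sup>2))"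
  proof -
    have e: "q * q_int q n = q_int q n + q ^ n - 1"
      using q_int_Suc[of q n] q_int_Suc'[of q n] by linarith
    have "q_int q (Suc (Suc n)) = q_int q n + q ^ n + q * q ^ n"
      by (simp add: q_int_Suc)
    then show ?thesis
      unfolding e q_int_Suc[of q n] by (simp add: algebra_simps power2_eq_square)
  qed
  finally show ?case .
qed simp

section \<open>The q-integral\<close>

lemma summable_q_integral:
  fixes f :: "real \<Rightarrow> real"
  assumes "0 < q" "q < 1" "continuous_on {0..1} f"
  shows "summable (\<lambda>i. q ^ i * f (q ^ i))"
proof -
  obtain M where M: "M \<ge> 0" "\<And>x. x \<in> {0..1} \<Longrightarrow> \<bar>f x\<bar> \<le> M"
    using continuous_on_unit_interval_bounded[OF assms(3)] by blast
  show ?thesis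
  proof (rule summable_comparison_test')
    show "summable (\<lambda>i. q ^ i * M)"
      using assms by (intro summable_mult2 summable_geometric) auto
    show "norm (q ^ i * f (q ^ i)) \<le> q ^ i * M" for i
      using assms by (auto simp: abs_mult power_le_one intro!: mult_left_mono M(2))
  qed
qed

lemma q_integral_mono:
  fixes f g :: "real \<Rightarrow> real"
  assumes q: "0 < q" "q \<le> 1" and "continuous_on {0..1} f" "continuous_on {0..1} g"
    and le: "\<And>t. t \<in> {0..1} \<Longrightarrow> f t \<le> g t"
  shows "q_integral q f \<le> q_integral q g"
proof (cases "q = 1")
  case True
  then show ?thesis
    using assms by (auto simp: q_integral_def intro!: integral_le integrable_continuous_real)
next
  case False
  then have "q < 1" using q by simp
  have "(\<Sum>i. q ^ i * f (q ^ i)) \<le> (\<Sum>i. q ^ i * g (q ^ i))"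
    using assms \<open>q < 1\<close>
    by (intro suminf_le summable_q_integral mult_left_mono le) (auto simp: power_le_one)
  then show ?thesis
    using False \<open>q < 1\<close> by (simp add: q_integral_def)
qed

lemma q_integral_add:
  fixes f g :: "real \<Rightarrow> real"
  assumes "0 < q" "q \<le> 1" "continuous_on {0..1} f" "continuous_on {0..1} g"
  shows "q_integral q (\<lambda>t. f t + g t) = q_integral q f + q_integral q g"
proof (cases "q = 1")
  case True
  then show ?thesis
    using assms by (simp add: q_integral_def integral_add integrable_continuous_real)
next
  case False
  then have "q < 1" using assms by simp
  then show ?thesis
    using False suminf_add[OF summable_q_integral[OF assms(1) \<open>q < 1\<close> assms(3)]
        summable_q_integral[OF assms(1) \<open>q < 1\<close> assms(4)]]
    by (simp add: q_integral_def distrib_left[symmetric])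
qed

lemma q_integral_cmult:
  fixes f :: "real \<Rightarrow> real"
  assumes "0 < q" "q \<le> 1" "continuous_on {0..1} f"
  shows "q_integral q (\<lambda>t. c * f t) = c * q_integral q f"
proof (cases "q = 1")
  case True
  then show ?thesis by (simp add: q_integral_def)
next
  case False
  then have "q < 1" using assms by simp
  then show ?thesis
    using False suminf_mult[OF summable_q_integral[OF assms(1) \<open>q < 1\<close> assms(3)], of c]
    by (simp add: q_integral_def mult.left_commute)
qed

lemma q_integral_power:
  assumes "0 < q" "q \<le> 1"
  shows "q_integral q (\<lambda>t. t ^ a) = 1 / q_int q (Suc a)"
proof (cases "q = 1")
  case True
  have "((\<lambda>t::real. t ^ a) has_integral (1 ^ Suc a / real (Suc a) - 0 ^ Suc a / real (Suc a))) {0..1}"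
    by (rule fundamental_theorem_of_calculus)
      (auto simp: has_real_derivative_iff_has_vector_derivative[symmetric]
        intro!: derivative_eq_intros simp del: of_nat_Suc power_Suc)
  then show ?thesis
    using True by (simp add: q_integral_def q_int_def integral_unique)
next
  case False
  then have "q < 1" using assms by simp
  have "\<bar>q ^ Suc a\<bar> < 1"
    using assms \<open>q < 1\<close> power_Suc_less_one[of q a] by (simp add: abs_mult power_abs)
  then have "(\<Sum>i. (q ^ Suc a) ^ i) = 1 / (1 - q ^ Suc a)"
    by (intro suminf_geometric) simp
  moreover have "q ^ i * (q ^ i) ^ a = (q ^ Suc a) ^ i" for i
    by (simp add: power_mult[symmetric] power_add[symmetric] algebra_simps)
  ultimately show ?thesis
    using False \<open>q < 1\<close> by (simp add: q_integral_def q_int_def)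
qed

text \<open>
  Splitting off the last factor of the product expresses the integral with \<open>b + 1\<close> factors by two
  integrals with \<open>b\<close> factors.
\<close>

lemma q_beta_integral:
  assumes "0 < q" "q \<le> 1"
  shows "q_integral q (\<lambda>t. t ^ a * (\<Prod>s<b. 1 - q ^ s * (q * t))) =
    q_fact q a * q_fact q b / q_fact q (Suc (a + b))"
proof (induction b arbitrary: a)
  case 0
  have "q_fact q a \<noteq> 0" using q_fact_pos[OF assms(1), of a] by simp
  then show ?case using q_integral_power[OF assms] by (simp add: q_fact_Suc)
next
  case (Suc b)
  define B where "B a t = t ^ a * (\<Prod>s<b. 1 - q ^ s * (q * t))" for a and t :: real
  have cont: "continuous_on {0..1} (B a)" for a
    unfolding B_def by (intro continuous_intros)
  have "q_integral q (\<lambda>t. t ^ a * (\<Prod>s<Suc b. 1 - q ^ s * (q * t))) =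
      q_integral q (\<lambda>t. B a t + (- (q ^ Suc b)) * B (Suc a) t)"
    by (simp add: B_def algebra_simps)
  also have "\<dots> = q_integral q (B a) + (- (q ^ Suc b)) * q_integral q (B (Suc a))"
    by (simp only: q_integral_add[OF assms cont continuous_on_mult_left[OF cont]]
        q_integral_cmult[OF assms cont])
  also have "\<dots> = q_fact q a * q_fact q b / q_fact q (Suc (a + b)) -
      q ^ Suc b * (q_fact q (Suc a) * q_fact q b / q_fact q (Suc (Suc (a + b))))"
    using Suc.IH[of a] Suc.IH[of "Suc a"] by (simp add: B_def[abs_def])
  also have "\<dots> = q_fact q a * q_fact q (Suc b) / q_fact q (Suc (Suc (a + b)))"
  proof -
    define F N where "F = q_fact q (Suc (a + b))" and "N = q_int q (Suc (Suc (a + b)))"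
    have "q_int q (Suc a + Suc b) = q_int q (Suc b) + q ^ Suc b * q_int q (Suc a)"
      by (rule q_int_add)
    then have N: "N = q_int q (Suc b) + q ^ Suc b * q_int q (Suc a)"
      by (simp add: N_def)
    have "F \<noteq> 0" "N \<noteq> 0"
      using q_fact_pos[OF assms(1), of "Suc (a + b)"] q_int_pos[OF assms(1), of "Suc (Suc (a + b))"]
      by (auto simp: F_def N_def)
    moreover have "q_fact q (Suc (Suc (a + b))) = F * N"
      by (simp add: F_def N_def q_fact_Suc)
    moreover have "q_fact q (Suc a) = q_fact q a * q_int q (Suc a)"
      "q_fact q (Suc b) = q_fact q b * q_int q (Suc b)"
      by (rule q_fact_Suc)+
    moreover have "A * B / F - r * (A * y * B / (F * N)) = A * (B * z) / (F * N)"
      if "N = z + r * y" "F \<noteq> 0" "N \<noteq> 0" for A B F N r y z :: real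
      using that(2,3) by (simp add: field_simps) (simp add: that(1) algebra_simps)
    ultimately show ?thesis
      unfolding F_def[symmetric] using N by simp
  qed
  finally show ?case by simp
qed

section \<open>The operator\<close>

lemma continuous_on_q_bernstein [continuous_intros]:
  "continuous_on S g \<Longrightarrow> continuous_on S (\<lambda>t. q_bernstein n j q (g t))"
  unfolding q_bernstein_def by (intro continuous_intros)

lemma q_bernstein_nonneg:
  assumes "0 < q" "q \<le> 1" "x \<in> {0..1}"
  shows "0 \<le> q_bernstein n j q x"
proof -
  have "0 \<le> 1 - q ^ s * x" for s
    using assms power_le_one[of q s] mult_le_one[of "q ^ s" x] by auto
  moreover have "0 \<le> q_binomial q n j"
    using q_fact_pos[OF assms(1)] by (simp add: q_binomial_def less_imp_le)
  ultimately show ?thesis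
    using assms by (auto simp: q_bernstein_def intro!: mult_nonneg_nonneg prod_nonneg)
qed

lemma continuous_on_q_bernstein_durrmeyer:
  "continuous_on S (q_bernstein_durrmeyer n q f)"
  unfolding q_bernstein_durrmeyer_def[abs_def] by (intro continuous_intros)

lemma q_bernstein_durrmeyer_mono:
  assumes q: "0 < q" "q \<le> 1" and cont: "continuous_on {0..1} f" "continuous_on {0..1} g"
    and le: "\<And>t. t \<in> {0..1} \<Longrightarrow> f t \<le> g t" and x: "x \<in> {0..1}"
  shows "q_bernstein_durrmeyer n q f x \<le> q_bernstein_durrmeyer n q g x"
proof -
  have "q_integral q (\<lambda>t. q_bernstein (n - 2) (j - 1) q (q * t) * f t) \<le>
      q_integral q (\<lambda>t. q_bernstein (n - 2) (j - 1) q (q * t) * g t)" for j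
    using q by (intro q_integral_mono mult_left_mono continuous_intros cont le q_bernstein_nonneg)
      (auto intro: mult_le_one)
  then show ?thesis
    unfolding q_bernstein_durrmeyer_def using q x
    by (intro add_mono mult_right_mono mult_left_mono sum_mono mult_nonneg_nonneg
        q_bernstein_nonneg q_int_nonneg le) auto
qed

text \<open>The factor \<open>q powi (1 - int j)\<close> cancels the power of \<open>q\<close> coming from \<open>(q * t) ^ (j - 1)\<close>.\<close>

lemma q_durrmeyer_weight_power:
  assumes q: "0 < q" "q \<le> 1" and j: "1 \<le> j" "j < n"
  shows "q_int q (n - 1) * q powi (1 - int j) *
      q_integral q (\<lambda>t. q_bernstein (n - 2) (j - 1) q (q * t) * t ^ k) =
    q_fact q (n - 1) * q_fact q (j - 1 + k) / (q_fact q (j - 1) * q_fact q (n - 1 + k))"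
proof -
  from j obtain i where i: "j = Suc i" by (cases j) auto
  from j(2) obtain b where n: "n = Suc (Suc (i + b))"
    unfolding i using less_imp_Suc_add[of "Suc i" n] by auto
  define B where "B t = t ^ (i + k) * (\<Prod>s<b. 1 - q ^ s * (q * t))" for t :: real
  have "q_bernstein (n - 2) (j - 1) q (q * t) * t ^ k =
      q_binomial q (i + b) i * q ^ i * B t" for t
    by (simp add: q_bernstein_def n i B_def power_mult_distrib power_add)
  moreover have "continuous_on {0..1} B"
    unfolding B_def by (intro continuous_intros)
  ultimately have "q_integral q (\<lambda>t. q_bernstein (n - 2) (j - 1) q (q * t) * t ^ k) =
      q_binomial q (i + b) i * q ^ i * q_integral q B"
    by (simp add: q_integral_cmult q)
  also have "q_integral q B = q_fact q (i + k) * q_fact q b / q_fact q (Suc (i + k + b))"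
    unfolding B_def by (rule q_beta_integral[OF q])
  finally have "q_integral q (\<lambda>t. q_bernstein (n - 2) (j - 1) q (q * t) * t ^ k) = \<dots> *
      (q_binomial q (i + b) i * q ^ i)"
    by simp
  moreover have "q powi (1 - int j) * q ^ i = 1"
    using q by (simp add: i power_int_minus)
  then have "q powi (1 - int j) = 1 / q ^ i"
    using q by (simp add: field_simps)
  moreover have "q_fact q b \<noteq> 0"
    using q_fact_pos[OF q(1), of b] by simp
  ultimately show ?thesis
    using q by (simp add: n i q_binomial_def q_fact_Suc add_ac mult_ac)
qed

text \<open>
  The weighted integrals of \<open>t\<close> and \<open>t\<^sup>2\<close> are \<open>[j]/[n]\<close> and \<open>[j][j+1]/([n][n+1])\<close>. Both expressions
  are \<open>0\<close> for \<open>j = 0\<close> and \<open>1\<close> for \<open>j = n\<close>, so the two endpoint evaluations of the operator fit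
  the same formula and a single sum over the whole basis remains.
\<close>

lemma q_bernstein_durrmeyer_quadratic:
  assumes q: "0 < q" "q \<le> 1" and n: "n \<ge> 1"
  shows "q_bernstein_durrmeyer n q (\<lambda>t. a + b * t + c * t\<^sup>2) x =
    (\<Sum>j\<le>n. q_bernstein n j q x *
      (a + b / q_int q n * q_int q j +
        c / (q_int q n * q_int q (Suc n)) * (q_int q j * q_int q (Suc j))))"
proof -
  define F where "F j = a + b / q_int q n * q_int q j +
    c / (q_int q n * q_int q (Suc n)) * (q_int q j * q_int q (Suc j))" for j
  have nz: "q_int q n \<noteq> 0" "q_int q (Suc n) \<noteq> 0"
    using q_int_pos[OF q(1), of n] q_int_pos[OF q(1), of "Suc n"] n by auto
  have F0: "F 0 = a" by (simp add: F_def)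
  have Fn: "F n = a + b + c" using nz by (simp add: F_def)
  have mid: "q_int q (n - 1) * (q powi (1 - int j) * q_bernstein n j q x *
      q_integral q (\<lambda>t. q_bernstein (n - 2) (j - 1) q (q * t) * (a + b * t + c * t\<^sup>2))) =
      q_bernstein n j q x * F j" if j: "j \<in> {1..n - 1}" for j
  proof -
    define w where "w = q_int q (n - 1) * q powi (1 - int j)"
    define I where "I k = q_integral q (\<lambda>t. q_bernstein (n - 2) (j - 1) q (q * t) * t ^ k)" for k
    have j': "1 \<le> j" "j < n" using j by auto
    obtain i l where i: "j = Suc i" and l: "n = Suc l"
      using j' by (cases j; cases n) auto
    have pos: "q_fact q i \<noteq> 0" "q_fact q l \<noteq> 0"
      using q_fact_pos[OF q(1), of i] q_fact_pos[OF q(1), of l] by auto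
    have wI: "w * I k = q_fact q l * q_fact q (i + k) / (q_fact q i * q_fact q (l + k))" for k
      using q_durrmeyer_weight_power[OF q j', of k] by (simp add: w_def I_def i l)
    have "w * I 0 = 1" "w * I 1 = q_int q j / q_int q n"
      "w * I 2 = q_int q j * q_int q (Suc j) / (q_int q n * q_int q (Suc n))"
      using pos nz by (simp_all add: wI q_fact_Suc i l numeral_2_eq_2)
    moreover have "q_integral q (\<lambda>t. q_bernstein (n - 2) (j - 1) q (q * t) * (a + b * t + c * t\<^sup>2)) =
        a * I 0 + b * I 1 + c * I 2"
    proof -
      define p where "p k t = q_bernstein (n - 2) (j - 1) q (q * t) * t ^ k" for k t
      have cp: "continuous_on {0..1} (p k)" for k
        unfolding p_def by (intro continuous_intros)
      have "q_integral q (\<lambda>t. q_bernstein (n - 2) (j - 1) q (q * t) * (a + b * t + c * t\<^sup>2)) =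
          q_integral q (\<lambda>t. (a * p 0 t + b * p 1 t) + c * p 2 t)"
        by (simp add: p_def algebra_simps)
      also have "\<dots> = a * q_integral q (p 0) + b * q_integral q (p 1) + c * q_integral q (p 2)"
        using q cp by (simp add: q_integral_add q_integral_cmult continuous_intros)
      finally show ?thesis by (simp add: I_def p_def[abs_def])
    qed
    ultimately have "w * q_integral q (\<lambda>t. q_bernstein (n - 2) (j - 1) q (q * t) *
        (a + b * t + c * t\<^sup>2)) = F j"
      by (simp add: F_def distrib_left mult.left_commute[of w])
    then show ?thesis
      by (simp add: w_def mult_ac)
  qed
  have "{..n} = insert 0 (insert n {1..n - 1})" using n by auto
  then have "(\<Sum>j\<le>n. q_bernstein n j q x * F j) =
      q_bernstein n 0 q x * F 0 + (q_bernstein n n q x * F n + (\<Sum>j=1..n - 1. q_bernstein n j q x * F j))"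
    using n by auto
  moreover have "q_bernstein_durrmeyer n q (\<lambda>t. a + b * t + c * t\<^sup>2) x =
      a * q_bernstein n 0 q x + (a + b + c) * q_bernstein n n q x +
      (\<Sum>j=1..n - 1. q_bernstein n j q x * F j)"
    unfolding q_bernstein_durrmeyer_def sum_distrib_left by (subst sum.cong[OF refl mid]) auto
  ultimately show ?thesis
    unfolding F_def[symmetric] by (simp add: F0 Fn)
qed

lemma q_bernstein_durrmeyer_eigen:
  assumes q: "0 < q" "q \<le> 1" and n: "n \<ge> 1"
  shows "q_bernstein_durrmeyer n q (\<lambda>t. a + b * t + c * (t * (1 - t))) x =
    a + b * x + c * ((1 - q_int q 2 / q_int q (n + 1)) * (x * (1 - x)))"
proof -
  have nz: "q_int q n \<noteq> 0" "q_int q (Suc n) \<noteq> 0"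
    using q_int_pos[OF q(1), of n] q_int_pos[OF q(1), of "Suc n"] n by auto
  have q2: "q_int q 2 = 1 + q"
    by (simp add: numeral_2_eq_2 q_int_Suc)
  define B C where "B = (b + c) / q_int q n" and "C = - c / (q_int q n * q_int q (Suc n))"
  have "(\<lambda>t. a + b * t + c * (t * (1 - t))) = (\<lambda>t. a + (b + c) * t + (- c) * t\<^sup>2)"
    by (simp add: algebra_simps power2_eq_square)
  then have "q_bernstein_durrmeyer n q (\<lambda>t. a + b * t + c * (t * (1 - t))) x =
      (\<Sum>j\<le>n. q_bernstein n j q x * (a + B * q_int q j + C * (q_int q j * q_int q (Suc j))))"
    using q_bernstein_durrmeyer_quadratic[OF assms, of a "b + c" "- c" x] by (simp add: B_def C_def)
  also have "\<dots> = a * (\<Sum>j\<le>n. q_bernstein n j q x) + B * (\<Sum>j\<le>n. q_bernstein n j q x * q_int q j) +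
      C * (\<Sum>j\<le>n. q_bernstein n j q x * (q_int q j * q_int q (Suc j)))"
    by (simp add: sum_distrib_left sum.distrib[symmetric] algebra_simps)
  also have "\<dots> = a + B * (q_int q n * x) +
      C * (q_int q n * (q_int q (Suc n) * x\<^sup>2 + (1 + q) * (x - x\<^sup>2)))"
    by (simp only: sum_q_bernstein[OF q(1)] sum_q_bernstein_q_int[OF q(1)]
        sum_q_bernstein_q_int_q_int_Suc[OF q(1)] mult_1_right)
  also have "\<dots> = a + (b + c) * x - c * (x\<^sup>2 + (1 + q) / q_int q (Suc n) * (x - x\<^sup>2))"
    using nz by (simp add: B_def C_def field_simps)
  finally show ?thesis
    by (simp add: q2 algebra_simps power2_eq_square)
qed

section \<open>Iterates\<close>

lemma continuous_on_q_bernstein_durrmeyer_iterate: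
  "continuous_on {0..1} f \<Longrightarrow> continuous_on {0..1} ((q_bernstein_durrmeyer n q ^^ m) f)"
  by (cases m) (simp_all add: continuous_on_q_bernstein_durrmeyer)

lemma q_bernstein_durrmeyer_iterate_mono:
  assumes q: "0 < q" "q \<le> 1" and cont: "continuous_on {0..1} f" "continuous_on {0..1} g"
    and le: "\<And>t. t \<in> {0..1} \<Longrightarrow> f t \<le> g t" and x: "x \<in> {0..1}"
  shows "(q_bernstein_durrmeyer n q ^^ m) f x \<le> (q_bernstein_durrmeyer n q ^^ m) g x"
  using x
proof (induction m arbitrary: x)
  case (Suc m)
  then show ?case
    by (auto intro!: q_bernstein_durrmeyer_mono[OF q] continuous_on_q_bernstein_durrmeyer_iterate cont)
qed (simp add: le)

lemma q_bernstein_durrmeyer_iterate_eigen: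
  assumes "0 < q" "q \<le> 1" "n \<ge> 1"
  shows "(q_bernstein_durrmeyer n q ^^ m) (\<lambda>t. a + b * t + c * (t * (1 - t))) =
    (\<lambda>x. a + b * x + c * (1 - q_int q 2 / q_int q (n + 1)) ^ m * (x * (1 - x)))"
proof (induction m)
  case (Suc m)
  show ?case
    by (simp only: funpow.simps comp_apply Suc.IH, rule ext)
      (simp add: q_bernstein_durrmeyer_eigen[OF assms])
qed simp

text \<open>
  For \<open>s = - 1\<close> and \<open>s = 1\<close> the functions \<open>g s\<close> of the proof are a lower and an upper bound for \<open>f\<close>;
  the iterates act on them exactly and preserve the two inequalities.
\<close>

lemma q_bernstein_durrmeyer_iterate_error:
  fixes f :: "real \<Rightarrow> real"
  assumes q: "0 < q" "q \<le> 1" "n \<ge> 1" and cont: "continuous_on {0..1} f"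
    and dev: "\<And>t. t \<in> {0..1} \<Longrightarrow> \<bar>f t - endpoint_interpolant f t\<bar> \<le> W + c * (t * (1 - t))"
    and x: "x \<in> {0..1}"
  shows "\<bar>(q_bernstein_durrmeyer n q ^^ m) f x - endpoint_interpolant f x\<bar> \<le>
    W + c * ((1 - q_int q 2 / q_int q (n + 1)) ^ m * x * (1 - x))"
proof -
  define g where "g s t = (f 0 + s * W) + (f 1 - f 0) * t + (s * c) * (t * (1 - t))"
    for s t :: real
  have g: "g s t = endpoint_interpolant f t + s * (W + c * (t * (1 - t)))" for s t
    by (simp add: g_def endpoint_interpolant_def algebra_simps)
  have cg: "continuous_on {0..1} (g s)" for s
    unfolding g_def by (intro continuous_intros)
  have "g (- 1) t \<le> f t \<and> f t \<le> g 1 t" if "t \<in> {0..1}" for t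
    using dev[OF that] unfolding g abs_le_iff mult_1 mult_minus1 by linarith
  then have "(q_bernstein_durrmeyer n q ^^ m) (g (- 1)) x \<le> (q_bernstein_durrmeyer n q ^^ m) f x"
    "(q_bernstein_durrmeyer n q ^^ m) f x \<le> (q_bernstein_durrmeyer n q ^^ m) (g 1) x"
    by (intro q_bernstein_durrmeyer_iterate_mono q cont cg x; simp)+
  moreover have "(q_bernstein_durrmeyer n q ^^ m) (g s) x = endpoint_interpolant f x +
      s * (W + c * ((1 - q_int q 2 / q_int q (n + 1)) ^ m * x * (1 - x)))" for s
    unfolding g_def q_bernstein_durrmeyer_iterate_eigen[OF q]
    by (simp add: endpoint_interpolant_def algebra_simps)
  ultimately show ?thesis
    by (simp add: abs_le_iff)
qed

lemma q_bernstein_durrmeyer_eigenvalue_nonneg: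
  assumes "0 < q" "n \<ge> 1"
  shows "0 \<le> 1 - q_int q 2 / q_int q (n + 1)"
proof -
  have "q_int q (n + 1) = q_int q 2 + q\<^sup>2 * q_int q (n - 1)"
    using q_int_add[of q "n - 1" 2] assms by simp
  then have "q_int q 2 \<le> q_int q (n + 1)"
    using q_int_nonneg[OF assms(1), of "n - 1"] by simp
  then show ?thesis
    using q_int_pos[OF assms(1), of "n + 1"] by simp
qed

lemma q_bernstein_durrmeyer_iterate_error_modulus:
  fixes f :: "real \<Rightarrow> real"
  assumes q: "0 < q" "q \<le> 1" "n \<ge> 1" and cont: "continuous_on {0..1} f" and x: "x \<in> {0..1}"
  shows "\<bar>(q_bernstein_durrmeyer n q ^^ m) f x - endpoint_interpolant f x\<bar> \<le>
    2 * second_modulus f (sqrt ((1 - q_int q 2 / q_int q (n + 1)) ^ m * x * (1 - x)))"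
proof -
  define v where "v = (1 - q_int q 2 / q_int q (n + 1)) ^ m * x * (1 - x)"
  define \<omega> where "\<omega> = second_modulus f (sqrt v)"
  have v: "v \<ge> 0"
    unfolding v_def using q_bernstein_durrmeyer_eigenvalue_nonneg[OF q(1,3)] x
    by (intro mult_nonneg_nonneg zero_le_power) auto
  have "\<bar>(q_bernstein_durrmeyer n q ^^ m) f x - endpoint_interpolant f x\<bar> \<le> 2 * \<omega> + e"
    if "e > 0" for e
  proof -
    have "sqrt v \<ge> 0" "e / 2 > 0" using v \<open>e > 0\<close> by auto
    then obtain c where c: "c * (sqrt v)\<^sup>2 \<le> \<omega> + e / 2"
      "\<And>t. t \<in> {0..1} \<Longrightarrow> \<bar>f t - endpoint_interpolant f t\<bar> \<le> \<omega> + e / 2 + c * (t * (1 - t))"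
      using chord_deviation_modulus[OF cont] unfolding \<omega>_def by blast
    have "\<bar>(q_bernstein_durrmeyer n q ^^ m) f x - endpoint_interpolant f x\<bar> \<le> \<omega> + e / 2 + c * v"
      unfolding v_def by (rule q_bernstein_durrmeyer_iterate_error[OF q cont c(2) x])
    then show ?thesis using c(1) v by simp
  qed
  then show ?thesis
    unfolding \<omega>_def v_def by (rule field_le_epsilon)
qed

theorem theorem12:
  shows "\<exists>k::real. k > 0 \<and>
    (\<forall>(q::real) (n::nat) (m::nat) (f::real \<Rightarrow> real) (x::real).
       0 < q \<longrightarrow> q \<le> 1 \<longrightarrow> n \<ge> 1 \<longrightarrow> m \<ge> 1 \<longrightarrow>
       continuous_on {0..1} f \<longrightarrow> x \<in> {0..1} \<longrightarrow>
       \<bar>(q_bernstein_durrmeyer n q ^^ m) f x - endpoint_interpolant f x\<bar>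
         \<le> k * second_modulus f (sqrt ((1 - q_int q 2 / q_int q (n + 1)) ^ m * x * (1 - x))))"
  using q_bernstein_durrmeyer_iterate_error_modulus by (intro exI[of _ 2]) simp

end
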